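(* Let $G$ and $H$ be two connected non-trivial graphs. Then for each $\ast \in \{\boxtimes, \circ\}$, $\Phi_c(G \ast H) = \Theta_c(G \ast H) = \chi(G \ast H)$.
   Context: Graphs are finite, simple and undirected; non-trivial means having at least two vertices. A set $S \subseteq V(G)$ is $\Delta$-convex if there is no vertex $w \in V(G)\setminus S$ that forms a triangle (three pairwise adjacent vertices) with two vertices of $S$. A $\Delta$-convex $p$-cover of $G$ is a family of $p$ $\Delta$-convex sets whose union is $V(G)$ and such that every member has an element belonging to no other member; a $\Delta$-convex $p$-partition is a $\Delta$-convex $p$-cover whose members are pairwise disjoint. For a graph $G$ of order at least $2$, the $\Delta$-cover number $\Phi_c(G)$ (respectively, the $\Delta$-partition number $\Theta_c(G)$) is the minimum $p \ge 2$ such that $G$ admits a $\Delta$-convex $p$-cover (respectively, $\Delta$-convex $p$-partition). $\chi$ denotes the chromatic number. Both products have vertex set $V(G)\times V(H)$. In the strong product $G \boxtimes H$, $(g_1,h_1)$ and $(g_2,h_2)$ are adjacent if $g_1=g_2$ and $h_1h_2\in E(H)$, or $h_1=h_2$ and $g_1g_2 \in E(G)$, or $g_1g_2\in E(G)$ and $h_1h_2\in E(H)$. In the lexicographic product $G \circ H$, $(g_1,h_1)$ and $(g_2,h_2)$ are adjacent if either $g_1g_2\in E(G)$, or $g_1=g_2$ and $h_1h_2\in E(H)$. *)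

theory Defs
  imports "Graph_Theory.Graph_Theory"
begin

text \<open>
  A finite simple undirected graph is a \<^locale>\<open>pair_graph\<close>: a finite, symmetric, loop-free digraph
  whose arcs are pairs of vertices. Connectedness is the library's
  \<^const>\<open>Digraph_Component.connected\<close>.
\<close>

definition triangle :: "'a pair_pre_digraph \<Rightarrow> 'a \<Rightarrow> 'a \<Rightarrow> 'a \<Rightarrow> bool" where
  "triangle G u v w \<longleftrightarrow> (u, v) \<in> parcs G \<and> (v, w) \<in> parcs G \<and> (u, w) \<in> parcs G"

definition delta_convex :: "'a pair_pre_digraph \<Rightarrow> 'a set \<Rightarrow> bool" where
  "delta_convex G S \<longleftrightarrow>
    S \<subseteq> pverts G \<and> \<not> (\<exists>w \<in> pverts G - S. \<exists>u \<in> S. \<exists>v \<in> S. triangle G u v w)"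

text \<open>
  Families are modelled as sets of sets: the private-element condition forces the members of an
  indexed family to be nonempty and pairwise distinct, so no repetition is lost.
\<close>

definition delta_convex_cover :: "'a pair_pre_digraph \<Rightarrow> nat \<Rightarrow> 'a set set \<Rightarrow> bool" where
  "delta_convex_cover G p \<F> \<longleftrightarrow>
    finite \<F> \<and> card \<F> = p \<and> (\<forall>S \<in> \<F>. delta_convex G S) \<and> \<Union>\<F> = pverts G \<and>
    (\<forall>S \<in> \<F>. \<exists>x \<in> S. \<forall>T \<in> \<F>. T \<noteq> S \<longrightarrow> x \<notin> T)"

definition delta_convex_partition :: "'a pair_pre_digraph \<Rightarrow> nat \<Rightarrow> 'a set set \<Rightarrow> bool" where
  "delta_convex_partition G p \<F> \<longleftrightarrow> delta_convex_cover G p \<F> \<and> pairwise disjnt \<F>"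

definition delta_cover_number :: "'a pair_pre_digraph \<Rightarrow> nat" where
  "delta_cover_number G = (LEAST p. p \<ge> 2 \<and> (\<exists>\<F>. delta_convex_cover G p \<F>))"

definition delta_partition_number :: "'a pair_pre_digraph \<Rightarrow> nat" where
  "delta_partition_number G = (LEAST p. p \<ge> 2 \<and> (\<exists>\<F>. delta_convex_partition G p \<F>))"

definition proper_coloring :: "'a pair_pre_digraph \<Rightarrow> nat \<Rightarrow> ('a \<Rightarrow> nat) \<Rightarrow> bool" where
  "proper_coloring G k c \<longleftrightarrow>
    c ` pverts G \<subseteq> {..<k} \<and> (\<forall>(u, v) \<in> parcs G. c u \<noteq> c v)"

definition chromatic_number :: "'a pair_pre_digraph \<Rightarrow> nat" where
  "chromatic_number G = (LEAST k. \<exists>c. proper_coloring G k c)"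

definition strong_product ::
    "'a pair_pre_digraph \<Rightarrow> 'b pair_pre_digraph \<Rightarrow> ('a \<times> 'b) pair_pre_digraph"
    (infixl "\<boxtimes>" 70) where
  "G \<boxtimes> H = \<lparr> pverts = pverts G \<times> pverts H,
     parcs = {((g1, h1), (g2, h2)) | g1 h1 g2 h2.
       g1 \<in> pverts G \<and> g2 \<in> pverts G \<and> h1 \<in> pverts H \<and> h2 \<in> pverts H \<and>
       (g1 = g2 \<and> (h1, h2) \<in> parcs H \<or>
        h1 = h2 \<and> (g1, g2) \<in> parcs G \<or>
        (g1, g2) \<in> parcs G \<and> (h1, h2) \<in> parcs H)} \<rparr>"

definition lexicographic_product ::
    "'a pair_pre_digraph \<Rightarrow> 'b pair_pre_digraph \<Rightarrow> ('a \<times> 'b) pair_pre_digraph"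
    (infixl "\<odot>" 70) where
  "G \<odot> H = \<lparr> pverts = pverts G \<times> pverts H,
     parcs = {((g1, h1), (g2, h2)) | g1 h1 g2 h2.
       g1 \<in> pverts G \<and> g2 \<in> pverts G \<and> h1 \<in> pverts H \<and> h2 \<in> pverts H \<and>
       ((g1, g2) \<in> parcs G \<or> g1 = g2 \<and> (h1, h2) \<in> parcs H)} \<rparr>"

lemma pair_graph_iff:
  "pair_graph G \<longleftrightarrow>
    finite (pverts G) \<and> parcs G \<subseteq> pverts G \<times> pverts G \<and> sym (parcs G) \<and> irrefl (parcs G)"
  (is "_ \<longleftrightarrow> ?R")
proof
  assume "pair_graph G"
  then interpret pair_graph G .
  show ?R
    using pair_finite_verts arc_fst_in_verts arc_snd_in_verts arcs_symmetric no_loops'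
    by (auto simp: sym_def irrefl_def intro: in_arcsD1 in_arcsD2)
next
  assume R: ?R
  then have "finite (parcs G)" by (meson finite_SigmaI finite_subset)
  with R show "pair_graph G"
    by unfold_locales (auto simp: symmetric_def irrefl_def)
qed

lemma pair_graph_strong_product:
  assumes "pair_graph G" "pair_graph H" shows "pair_graph (G \<boxtimes> H)"
  using assms by (auto simp: pair_graph_iff strong_product_def sym_def irrefl_def)

lemma pair_graph_lexicographic_product:
  assumes "pair_graph G" "pair_graph H" shows "pair_graph (G \<odot> H)"
  using assms by (auto simp: pair_graph_iff lexicographic_product_def sym_def irrefl_def)

text \<open>The minima above are taken over nonempty sets.\<close>

lemma delta_convex_partition_singletons:
  assumes "pair_graph G"
  shows "delta_convex_partition G (card (pverts G)) ((\<lambda>v. {v}) ` pverts G)"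
  using assms
  by (auto simp: delta_convex_partition_def delta_convex_cover_def delta_convex_def triangle_def
      pair_graph_iff irrefl_def pairwise_def disjnt_def card_image)

lemma proper_coloring_exists:
  assumes "pair_graph G" shows "\<exists>k c. proper_coloring G k c"
proof -
  from assms have "finite (pverts G)" by (simp add: pair_graph_iff)
  then obtain c :: "'a \<Rightarrow> nat" and n where c: "c ` pverts G = {i. i < n}" "inj_on c (pverts G)"
    using finite_imp_inj_to_nat_seg by metis
  have "c u \<noteq> c v" if "(u, v) \<in> parcs G" for u v
    using that assms inj_onD[OF c(2), of u v] by (auto simp: pair_graph_iff irrefl_def)
  with c(1) have "proper_coloring G n c"
    by (auto simp: proper_coloring_def)
  then show ?thesis by blast
qed

end

theory Submission
  imports Defs
begin

text \<open>
  In both products, a convex set containing an edge is the whole vertex set: closing the edge under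
  triangles gives an edge inside a layer \<open>{g} \<times> V(H)\<close>, which spreads along \<open>G\<close> to all its parallel
  copies; the resulting edges inside the layers \<open>V(G) \<times> {h}\<close> then spread along \<open>H\<close>. Hence the
  proper convex sets are exactly the proper independent sets, and convex covers correspond to
  colourings.
\<close>

section \<open>Induction along connected graphs and closure under triangles\<close>

text \<open>Connectedness is defined through the symmetric closure; since the arcs are already
  symmetric, it yields directed reachability, so induction needs only the forward step.\<close>

lemma connected_induct:
  assumes "pair_graph G" and "Digraph_Component.connected (with_proj G)"
    and "x \<in> pverts G" and "P x"
    and step: "\<And>u v. (u, v) \<in> parcs G \<Longrightarrow> P u \<Longrightarrow> P v"
    and "y \<in> pverts G"
  shows "P y"
proof -
  interpret pair_graph G by fact
  have "x \<rightarrow>\<^sup>*\<^bsub>with_proj G\<^esub> y"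
    using assms(2,3,6) symmetric_connected_imp_strongly_connected[OF sym_arcs]
    by (auto simp: strongly_connected_def)
  then show ?thesis
    using \<open>P x\<close> by (induction rule: reachable_induct) (auto intro: step)
qed

lemma connected_has_neighbour:
  assumes "pair_graph G" and "Digraph_Component.connected (with_proj G)"
    and "card (pverts G) \<ge> 2" and "x \<in> pverts G"
  obtains y where "(x, y) \<in> parcs G"
proof (rule ccontr)
  assume "\<not> thesis"
  \<comment> \<open>With no arc leaving \<open>x\<close>, the property of being equal to
    \<open>x\<close> passes vacuously along arcs.\<close>
  with that have "y = x" if "y \<in> pverts G" for y
    using connected_induct[OF assms(1,2,4), of "\<lambda>v. v = x" y] that by blast
  then have "pverts G \<subseteq> {x}" by blast
  then have "card (pverts G) \<le> 1" using card_mono[of "{x}"] by fastforce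
  with assms(3) show False by simp
qed

lemma delta_convexD:
  assumes "delta_convex G S" and "pair_graph G" and "u \<in> S" and "v \<in> S"
    and "(u, v) \<in> parcs G" and "(v, w) \<in> parcs G" and "(u, w) \<in> parcs G"
  shows "w \<in> S"
  using assms unfolding delta_convex_def triangle_def pair_graph_iff by blast

text \<open>A triangle with two vertices in \<open>S\<close> has an edge inside
  \<open>S\<close>.\<close>

lemma independent_imp_delta_convex:
  assumes "S \<subseteq> pverts G" and "\<And>u v. u \<in> S \<Longrightarrow> v \<in> S \<Longrightarrow> (u, v) \<notin> parcs G"
  shows "delta_convex G S"
  using assms unfolding delta_convex_def triangle_def by blast

section \<open>Convex covers and colourings\<close>

text \<open>The interface between the two halves of the proof: beyond having an edge, this is all
  that the comparison of covers with colourings asks of a product.\<close>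

definition edge_spanning :: "'a pair_pre_digraph \<Rightarrow> bool" where
  "edge_spanning G \<longleftrightarrow>
    (\<forall>S u v. delta_convex G S \<longrightarrow> u \<in> S \<longrightarrow> v \<in> S \<longrightarrow> (u, v) \<in> parcs G \<longrightarrow> S = pverts G)"

text \<open>A member equal to the whole vertex set would leave no private element for a second member, so
  all members of a cover are independent.\<close>

lemma delta_convex_cover_imp_coloring:
  assumes G: "pair_graph G" "edge_spanning G" and F: "delta_convex_cover G p F" and "p \<ge> 2"
  shows "\<exists>c. proper_coloring G p c"
proof -
  from F have F': "finite F" "card F = p" "\<And>S. S \<in> F \<Longrightarrow> delta_convex G S" "\<Union>F = pverts G"
    "\<And>S. S \<in> F \<Longrightarrow> \<exists>x \<in> S. \<forall>T \<in> F. T \<noteq> S \<longrightarrow> x \<notin> T"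
    by (auto simp: delta_convex_cover_def)
  have ind: "(u, v) \<notin> parcs G" if "S \<in> F" "u \<in> S" "v \<in> S" for S u v
  proof
    assume "(u, v) \<in> parcs G"
    with that G(2) F'(3) have S: "S = pverts G" unfolding edge_spanning_def by blast
    have "\<exists>T \<in> F. T \<noteq> S"
    proof (rule ccontr)
      assume "\<not> ?thesis"
      then have "F \<subseteq> {S}" by blast
      then have "card F \<le> 1" using card_mono[of "{S}"] by fastforce
      with F'(2) \<open>p \<ge> 2\<close> show False by simp
    qed
    then obtain T where "T \<in> F" "T \<noteq> S" by blast
    with F'(4,5) S that(1) show False by blast
  qed
  obtain h where h: "bij_betw h F {0..<p}"
    using ex_bij_betw_finite_nat[OF F'(1)] F'(2) by blast
  \<comment> \<open>Members of a cover may overlap, so each vertex picks one member containing it.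
    Any choice gives a proper colouring, because the members are independent.\<close>
  define m where "m v = (SOME S. S \<in> F \<and> v \<in> S)" for v
  have m: "m v \<in> F \<and> v \<in> m v" if "v \<in> pverts G" for v
    unfolding m_def by (rule someI_ex) (use that F'(4) in blast)
  have "proper_coloring G p (\<lambda>v. h (m v))"
    unfolding proper_coloring_def
  proof (intro conjI subsetI ballI, goal_cases)
    case (1 x)
    then show ?case using m bij_betwE[OF h] by auto
  next
    case (2 e)
    obtain u v where e: "e = (u, v)" by (cases e)
    with 2 G(1) have uv: "u \<in> pverts G" "v \<in> pverts G" by (auto simp: pair_graph_iff)
    have "m u \<noteq> m v" using ind m uv 2 e by metis
    then show ?case using m uv e h by (auto simp: bij_betw_def inj_on_def)
  qed
  then show ?thesis by blast
qed

lemma proper_coloring_merge: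
  assumes "proper_coloring G k c" and "i < k" and "i \<notin> c ` pverts G" and "pair_graph G"
  shows "proper_coloring G (k - 1) (\<lambda>v. if c v = k - 1 then i else c v)"
proof -
  have lt: "c v < k" "c v \<noteq> i" if "v \<in> pverts G" for v
    using assms that by (auto simp: proper_coloring_def)
  have arc: "u \<in> pverts G" "v \<in> pverts G" "c u \<noteq> c v" if "(u, v) \<in> parcs G" for u v
    using assms that by (auto simp: proper_coloring_def pair_graph_iff)
  have "(if c v = k - 1 then i else c v) < k - 1" if "v \<in> pverts G" for v
    using lt[OF that] \<open>i < k\<close> by auto
  moreover have "(if c u = k - 1 then i else c u) \<noteq> (if c v = k - 1 then i else c v)"
    if "(u, v) \<in> parcs G" for u v
    using lt arc[OF that] by metis
  ultimately show ?thesis unfolding proper_coloring_def by blast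
qed

text \<open>Colour classes are independent, hence convex. Minimality leaves no class empty, which
  provides the private elements and the exact number of members.\<close>

lemma minimal_coloring_imp_delta_convex_partition:
  assumes G: "pair_graph G" and c: "proper_coloring G (chromatic_number G) c"
  shows "\<exists>F. delta_convex_partition G (chromatic_number G) F"
proof -
  define k where "k = chromatic_number G"
  have min: "k \<le> j" if "proper_coloring G j d" for j d
    unfolding k_def chromatic_number_def by (rule Least_le) (use that in blast)
  have surj: "i \<in> c ` pverts G" if "i < k" for i
  proof (rule ccontr)
    assume "i \<notin> c ` pverts G"
    \<comment> \<open>Merging gives \<open>k \<le> k - 1\<close>, impossible because
      \<open>i < k\<close> makes \<open>k\<close> positive.\<close>
    from min[OF proper_coloring_merge[OF c[folded k_def] that this G]] that
    show False by simp
  qed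
  define K where "K i = {v \<in> pverts G. c v = i}" for i
  have lt: "c v < k" if "v \<in> pverts G" for v
    using c that by (auto simp: proper_coloring_def k_def)
  have ne: "\<exists>v. v \<in> K i" if "i < k" for i using surj[OF that] by (auto simp: K_def)
  \<comment> \<open>Disjoint nonempty classes are distinct, so the set of classes has exactly
    \<open>k\<close> elements.\<close>
  have inj: "inj_on K {..<k}"
  proof (rule inj_onI)
    fix i j assume "i \<in> {..<k}" "j \<in> {..<k}" "K i = K j"
    with ne[of i] show "i = j" by (auto simp: K_def)
  qed
  have conv: "delta_convex G (K i)" for i
    using c by (intro independent_imp_delta_convex) (auto simp: K_def proper_coloring_def)
  have "\<Union>(K ` {..<k}) = pverts G" using lt by (auto simp: K_def)
  moreover have "\<exists>x \<in> S. \<forall>T \<in> K ` {..<k}. T \<noteq> S \<longrightarrow> x \<notin> T" if S: "S \<in> K ` {..<k}" for S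
  proof -
    from S obtain i where "i < k" "S = K i" by auto
    with ne[of i] show ?thesis by (auto simp: K_def)
  qed
  moreover have "pairwise disjnt (K ` {..<k})"
    by (auto simp: pairwise_def disjnt_def K_def)
  ultimately have "delta_convex_partition G k (K ` {..<k})"
    using inj conv unfolding delta_convex_partition_def delta_convex_cover_def
    by (auto simp: card_image)
  then show ?thesis unfolding k_def by blast
qed

text \<open>The edge forces at least two colours, so the chromatic number is admissible in both
  minima. The colour classes attain it, and the lower bound for covers applies to partitions as
  well.\<close>

lemma edge_spanning_imp_numbers_eq:
  assumes G: "pair_graph G" "edge_spanning G" and e: "(u, v) \<in> parcs G"
  shows "delta_cover_number G = delta_partition_number G \<and>
    delta_partition_number G = chromatic_number G"
proof -
  let ?k = "chromatic_number G"
  obtain c where c: "proper_coloring G ?k c"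
    using LeastI_ex[OF proper_coloring_exists[OF G(1)]] unfolding chromatic_number_def by blast
  have "c u < ?k" "c v < ?k" "c u \<noteq> c v"
    using c e G(1) by (auto simp: proper_coloring_def pair_graph_iff)
  then have k2: "?k \<ge> 2" by linarith
  obtain F where F: "delta_convex_partition G ?k F"
    using minimal_coloring_imp_delta_convex_partition[OF G(1) c] by blast
  then have F': "delta_convex_cover G ?k F" by (simp add: delta_convex_partition_def)
  have lower: "?k \<le> p" if "p \<ge> 2" "delta_convex_cover G p F" for p F
    unfolding chromatic_number_def
    by (rule Least_le) (rule delta_convex_cover_imp_coloring[OF G that(2,1)])
  have "delta_cover_number G = ?k"
    unfolding delta_cover_number_def using k2 F' lower by (intro Least_equality) auto
  moreover have "delta_partition_number G = ?k"
    unfolding delta_partition_number_def using k2 F lower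
    by (intro Least_equality) (auto simp: delta_convex_partition_def)
  ultimately show ?thesis by simp
qed

section \<open>Spreading an edge through a product\<close>

text \<open>Every triangle used in the spreading lies in the strong product. Hence \<open>P\<close>
  may be any graph on the same vertices with at least these arcs, and one argument serves both
  products.\<close>

lemma delta_convex_layer_edge_eq_verts:
  assumes G: "pair_graph G" "Digraph_Component.connected (with_proj G)" "card (pverts G) \<ge> 2"
    and H: "pair_graph H" "Digraph_Component.connected (with_proj H)"
    and P: "pair_graph P" "pverts P = pverts G \<times> pverts H" "parcs (G \<boxtimes> H) \<subseteq> parcs P"
    and S: "delta_convex P S" "(g, h) \<in> S" "(g, h') \<in> S" and h: "(h, h') \<in> parcs H"
  shows "S = pverts P"
proof
  show sub: "S \<subseteq> pverts P" using S(1) by (simp add: delta_convex_def)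
  have vert: "(u, v) \<in> parcs G \<Longrightarrow> u \<in> pverts G \<and> v \<in> pverts G \<and> (v, u) \<in> parcs G"
    "(a, b) \<in> parcs H \<Longrightarrow> a \<in> pverts H \<and> b \<in> pverts H \<and> (b, a) \<in> parcs H" for u v a b
    using G(1) H(1) by (auto simp: pair_graph_iff sym_def)
  have arcs: "((u, a), (u', a')) \<in> parcs P"
    if "u \<in> pverts G" "u' \<in> pverts G" "a \<in> pverts H" "a' \<in> pverts H"
      "u = u' \<and> (a, a') \<in> parcs H \<or> a = a' \<and> (u, u') \<in> parcs G \<or>
       (u, u') \<in> parcs G \<and> (a, a') \<in> parcs H" for u u' a a'
    using that P(3) unfolding strong_product_def by auto
  note close = delta_convexD[OF S(1) P(1)]
  have g: "g \<in> pverts G" using sub S(2) P(2) by auto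
  have edge: "(x, h) \<in> S \<and> (x, h') \<in> S" if "x \<in> pverts G" for x
  proof (rule connected_induct[OF G(1,2) g _ _ that])
    fix u v assume "(u, v) \<in> parcs G" "(u, h) \<in> S \<and> (u, h') \<in> S"
    \<comment> \<open>Both \<open>(v, h)\<close> and \<open>(v, h')\<close> are adjacent to both
      ends of the edge from \<open>(u, h)\<close> to \<open>(u, h')\<close>.\<close>
    then have "(v, a) \<in> S" if "a = h \<or> a = h'" for a
      using vert(1)[of u v] vert(2)[OF h] h that
      by - (rule close[of "(u, h)" "(u, h')"], auto intro!: arcs)
    then show "(v, h) \<in> S \<and> (v, h') \<in> S" by blast
  qed (use S in blast)
  show "pverts P \<subseteq> S"
  proof
    fix z assume "z \<in> pverts P"
    then obtain x y where z: "z = (x, y)" "x \<in> pverts G" "y \<in> pverts H" using P(2) by auto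
    \<comment> \<open>The neighbour \<open>x'\<close> turns the copies over \<open>x\<close> and
      \<open>x'\<close> into an edge at height \<open>h\<close>; the same triangles with the factors
      exchanged carry it to height \<open>y\<close>.\<close>
    obtain x' where x': "(x, x') \<in> parcs G" using connected_has_neighbour[OF G z(2)] .
    have "(x, y) \<in> S \<and> (x', y) \<in> S"
    proof (rule connected_induct[OF H _ _ _ z(3)])
      show "h \<in> pverts H" using vert h by blast
      show "(x, h) \<in> S \<and> (x', h) \<in> S" using edge vert x' by blast
      fix u v assume "(u, v) \<in> parcs H" "(x, u) \<in> S \<and> (x', u) \<in> S"
      then have "(a, v) \<in> S" if "a = x \<or> a = x'" for a
        using vert(2)[of u v] vert(1)[OF x'] x' that
        by - (rule close[of "(x, u)" "(x', u)"], auto intro!: arcs)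
      then show "(x, v) \<in> S \<and> (x', v) \<in> S" by blast
    qed
    then show "z \<in> S" using z by simp
  qed
qed

lemma strong_product_parcs_subset_lexicographic:
  "parcs (G \<boxtimes> H) \<subseteq> parcs (G \<odot> H)"
  by (auto simp: strong_product_def lexicographic_product_def)

lemma edge_spanning_strong_product:
  assumes G: "pair_graph G" "Digraph_Component.connected (with_proj G)" "card (pverts G) \<ge> 2"
    and H: "pair_graph H" "Digraph_Component.connected (with_proj H)" "card (pverts H) \<ge> 2"
  shows "edge_spanning (G \<boxtimes> H)"
  unfolding edge_spanning_def
proof (intro allI impI)
  fix S x y assume S: "delta_convex (G \<boxtimes> H) S" "x \<in> S" "y \<in> S" "(x, y) \<in> parcs (G \<boxtimes> H)"
  obtain g1 h1 g2 h2 where xy: "x = (g1, h1)" "y = (g2, h2)" by (cases x, cases y)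
  have v: "g1 \<in> pverts G" "g2 \<in> pverts G" "h1 \<in> pverts H" "h2 \<in> pverts H"
    using S(4) by (auto simp: xy strong_product_def)
  have P: "pair_graph (G \<boxtimes> H)" by (rule pair_graph_strong_product[OF G(1) H(1)])
  have sym: "(a, b) \<in> parcs H \<Longrightarrow> (b, a) \<in> parcs H \<and> b \<in> pverts H"
    "(u, w) \<in> parcs G \<Longrightarrow> (w, u) \<in> parcs G" for a b u w
    using H(1) G(1) by (auto simp: pair_graph_iff sym_def)
  note close = delta_convexD[OF S(1) P S(2,3,4)]
  \<comment> \<open>The given edge is traded for one in the layer over \<open>g1\<close>. If
    \<open>h1 = h2\<close>, any neighbour \<open>h'\<close> of \<open>h1\<close> makes
    \<open>(g1, h')\<close> adjacent to both ends. Otherwise \<open>h' = h2\<close> works: the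
    corner \<open>(g1, h2)\<close> is either the second end itself or a common neighbour of the two
    ends.\<close>
  have "\<exists>h'. (h1, h') \<in> parcs H \<and> (g1, h') \<in> S"
  proof (cases "h1 = h2")
    case True
    obtain h' where h': "(h1, h') \<in> parcs H" using connected_has_neighbour[OF H v(3)] .
    then have "(g1, h') \<in> S"
      using S(4) v True sym(1)[of h1 h'] sym(2)[of g1 g2] H(1)
      by (intro close) (auto simp: xy strong_product_def pair_graph_iff irrefl_def)
    with h' show ?thesis by blast
  next
    case False
    with S(4) have h: "(h1, h2) \<in> parcs H" by (auto simp: xy strong_product_def)
    have "(g1, h2) \<in> S"
    proof (cases "g1 = g2")
      case True
      then show ?thesis using S(3) xy by simp
    next
      case g: False
      then show ?thesis
        using S(4) v False h sym(2)[of g1 g2]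
        by (intro close) (auto simp: xy strong_product_def)
    qed
    with h show ?thesis by blast
  qed
  then obtain h' where "(h1, h') \<in> parcs H" "(g1, h') \<in> S" by blast
  with S(2) show "S = pverts (G \<boxtimes> H)"
    by (intro delta_convex_layer_edge_eq_verts[OF G H(1,2) P _ _ S(1), of g1 h1 h'])
      (simp_all add: xy, simp add: strong_product_def)
qed

lemma edge_spanning_lexicographic_product:
  assumes G: "pair_graph G" "Digraph_Component.connected (with_proj G)" "card (pverts G) \<ge> 2"
    and H: "pair_graph H" "Digraph_Component.connected (with_proj H)" "card (pverts H) \<ge> 2"
  shows "edge_spanning (G \<odot> H)"
  unfolding edge_spanning_def
proof (intro allI impI)
  fix S x y assume S: "delta_convex (G \<odot> H) S" "x \<in> S" "y \<in> S" "(x, y) \<in> parcs (G \<odot> H)"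
  obtain g1 h1 g2 h2 where xy: "x = (g1, h1)" "y = (g2, h2)" by (cases x, cases y)
  have v: "g1 \<in> pverts G" "g2 \<in> pverts G" "h1 \<in> pverts H" "h2 \<in> pverts H"
    using S(4) by (auto simp: xy lexicographic_product_def)
  have P: "pair_graph (G \<odot> H)" by (rule pair_graph_lexicographic_product[OF G(1) H(1)])
  have "\<exists>h'. (h1, h') \<in> parcs H \<and> (g1, h') \<in> S"
  proof (cases "(g1, g2) \<in> parcs G")
    case True
    \<comment> \<open>Since \<open>g1\<close> and \<open>g2\<close> are adjacent,
      \<open>(g2, h2)\<close> is adjacent to the whole layer over \<open>g1\<close>, so any
      neighbour \<open>h'\<close> of \<open>h1\<close> closes a triangle.\<close>
    obtain h' where h': "(h1, h') \<in> parcs H" using connected_has_neighbour[OF H v(3)] .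
    then have "(g1, h') \<in> S"
      using v True G(1) H(1)
      by - (rule delta_convexD[OF S(1) P S(2,3,4)],
        auto simp: xy lexicographic_product_def pair_graph_iff sym_def)
    with h' show ?thesis by blast
  next
    case False
    \<comment> \<open>Here \<open>g1 = g2\<close>, so the given edge already lies in the layer and
      \<open>h' = h2\<close>.\<close>
    with S(3,4) show ?thesis by (auto simp: xy lexicographic_product_def)
  qed
  then obtain h' where "(h1, h') \<in> parcs H" "(g1, h') \<in> S" by blast
  with S(2) show "S = pverts (G \<odot> H)"
    by (intro delta_convex_layer_edge_eq_verts[OF G H(1,2) P _
          strong_product_parcs_subset_lexicographic S(1), of g1 h1 h'])
      (simp_all add: xy, simp add: lexicographic_product_def)
qed

theorem theorem16:
  fixes G :: "'a pair_pre_digraph" and H :: "'b pair_pre_digraph"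
  assumes "pair_graph G" and "Digraph_Component.connected (with_proj G)" and "card (pverts G) \<ge> 2"
    and "pair_graph H" and "Digraph_Component.connected (with_proj H)" and "card (pverts H) \<ge> 2"
  shows "\<forall>P \<in> {G \<boxtimes> H, G \<odot> H}.
    delta_cover_number P = delta_partition_number P \<and>
    delta_partition_number P = chromatic_number P"
proof -
  have "pverts G \<noteq> {}" "pverts H \<noteq> {}" using assms(3,6) by auto
  then obtain g h where g: "g \<in> pverts G" and h: "h \<in> pverts H" by blast
  \<comment> \<open>A single edge inside a layer belongs to both products and shows that neither is
    edgeless.\<close>
  obtain h' where "(h, h') \<in> parcs H" using connected_has_neighbour[OF assms(4-6) h] .
  then have e: "((g, h), (g, h')) \<in> parcs (G \<boxtimes> H)"
    using g h assms(4) by (auto simp: strong_product_def pair_graph_iff)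
  then have e': "((g, h), (g, h')) \<in> parcs (G \<odot> H)"
    using strong_product_parcs_subset_lexicographic by blast
  show ?thesis
    using edge_spanning_imp_numbers_eq[OF pair_graph_strong_product[OF assms(1,4)]
        edge_spanning_strong_product[OF assms] e]
      edge_spanning_imp_numbers_eq[OF pair_graph_lexicographic_product[OF assms(1,4)]
        edge_spanning_lexicographic_product[OF assms] e']
    by blast
qed

end
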